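(* Let $G=(V,E)$ be a finite simple graph and let $s\geq 2$ be an integer. A complex number $\lambda$ is an eigenvalue of the $s$-blowup $G^{[s]}$ if and only if $\lambda$ is an eigenvalue of some $2s$-weighted induced subgraph of $G$.
   Context: For a $k$-uniform hypergraph $H$ on $n$ vertices, its adjacency tensor $A_H=(a_{i_1\cdots i_k})$ is the order-$k$, dimension-$n$ tensor with $a_{i_1 i_2\cdots i_k}=\frac{1}{(k-1)!}$ if $\{i_1,\ldots,i_k\}$ is a hyperedge of $H$ and $0$ otherwise. A complex number $\lambda$ is an eigenvalue of $H$ if there is a nonzero $\mathbf{x}\in\mathbb{C}^n$ with $\lambda x_i^{k-1}=\sum_{i_2,\ldots,i_k=1}^n a_{i i_2\cdots i_k}x_{i_2}\cdots x_{i_k}$ for all $i$; equivalently, $\lambda x_v^{k-1}=\sum_{e\ni v}\prod_{u\in e\setminus\{v\}}x_u$ for every vertex $v$. The $s$-blowup $G^{[s]}$ of a graph $G=(V,E)$ is the $2s$-uniform hypergraph with vertex set $\bigcup_{i\in V}\mathbf{V}_i$, where the $\mathbf{V}_i$ are pairwise disjoint sets each of size $s$, and hyperedge set $\{\mathbf{V}_i\cup\mathbf{V}_j:\{i,j\}\in E\}$. A $2s$-weighted graph $G_\pi$ consists of an underlying graph $G=(V,E)$ together with a map $\pi:V\to\{\xi\in\mathbb{C}:\xi^{2s}=1\}$; its adjacency matrix $A(G_\pi)=(a^\pi_{ij})$ has $a^\pi_{ij}=\pi(i)\pi(j)$ if $\{i,j\}\in E$ and $0$ otherwise, and the eigenvalues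 of $G_\pi$ are the eigenvalues of $A(G_\pi)$. A $2s$-weighted induced subgraph of $G$ is a $2s$-weighted graph $\widehat G_\pi$ whose underlying graph $\widehat G$ is an induced subgraph of $G$ (with arbitrary such $\pi$ on its vertex set). Induced subgraphs are taken on nonempty vertex sets (a single vertex counts and has eigenvalue $0$). *)

theory Defs
  imports
    Complex_Main
    "HOL-Library.Disjoint_Sets"
    "HOL-Combinatorics.Multiset_Permutations"
    "Jordan_Normal_Form.Char_Poly"
begin

definition uniform_hypergraph :: "nat \<Rightarrow> 'v set \<Rightarrow> 'v set set \<Rightarrow> bool" where
  "uniform_hypergraph k V E \<longleftrightarrow> finite V \<and> (\<forall>e\<in>E. e \<subseteq> V \<and> card e = k)"

abbreviation finite_simple_graph :: "'v set \<Rightarrow> 'v set set \<Rightarrow> bool" where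
  "finite_simple_graph V E \<equiv> uniform_hypergraph 2 V E"

text \<open>An order-\<open>k\<close> tensor indexed by the vertices is a function on vertex lists, of which only
  the values at lists of length \<open>k\<close> matter.  Likewise a vector indexed by \<open>V\<close> is a function on the
  vertex type of which only the values on \<open>V\<close> matter.\<close>

definition adjacency_tensor :: "nat \<Rightarrow> 'v set set \<Rightarrow> 'v list \<Rightarrow> complex" where
  "adjacency_tensor k E vs = (if length vs = k \<and> set vs \<in> E then 1 / fact (k - 1) else 0)"

definition tensor_eigenvalue :: "nat \<Rightarrow> 'v set \<Rightarrow> ('v list \<Rightarrow> complex) \<Rightarrow> complex \<Rightarrow> bool" where
  "tensor_eigenvalue k V A \<mu> \<longleftrightarrow>
     (\<exists>x. (\<exists>v\<in>V. x v \<noteq> 0) \<and>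
       (\<forall>v\<in>V. \<mu> * x v ^ (k - 1) =
         (\<Sum>vs | set vs \<subseteq> V \<and> length vs = k - 1. A (v # vs) * (\<Prod>u\<leftarrow>vs. x u))))"

definition hypergraph_eigenvalue :: "nat \<Rightarrow> 'v set \<Rightarrow> 'v set set \<Rightarrow> complex \<Rightarrow> bool" where
  "hypergraph_eigenvalue k V E \<mu> \<longleftrightarrow> tensor_eigenvalue k V (adjacency_tensor k E) \<mu>"

text \<open>The sets \<open>B i\<close> are the classes replacing the vertices \<open>i\<close>; any choice of them is allowed.\<close>

definition blowup_classes :: "nat \<Rightarrow> 'v set \<Rightarrow> ('v \<Rightarrow> 'w set) \<Rightarrow> bool" where
  "blowup_classes s V B \<longleftrightarrow>
     disjoint_family_on B V \<and> (\<forall>i\<in>V. finite (B i) \<and> card (B i) = s)"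

definition blowup_verts :: "('v \<Rightarrow> 'w set) \<Rightarrow> 'v set \<Rightarrow> 'w set" where
  "blowup_verts B V = (\<Union>i\<in>V. B i)"

definition blowup_edges :: "('v \<Rightarrow> 'w set) \<Rightarrow> 'v set set \<Rightarrow> 'w set set" where
  "blowup_edges B E = {B i \<union> B j | i j. {i, j} \<in> E}"

definition induced_edges :: "'v set set \<Rightarrow> 'v set \<Rightarrow> 'v set set" where
  "induced_edges E W = {e \<in> E. e \<subseteq> W}"

definition root_weighting :: "nat \<Rightarrow> 'v set \<Rightarrow> ('v \<Rightarrow> complex) \<Rightarrow> bool" where
  "root_weighting m V \<pi> \<longleftrightarrow> (\<forall>i\<in>V. \<pi> i ^ m = 1)"

definition weighted_adjacency :: "'v set set \<Rightarrow> ('v \<Rightarrow> complex) \<Rightarrow> 'v \<Rightarrow> 'v \<Rightarrow> complex" where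
  "weighted_adjacency E \<pi> i j = (if {i, j} \<in> E then \<pi> i * \<pi> j else 0)"

definition indexed_eigenvalue :: "'v set \<Rightarrow> ('v \<Rightarrow> 'v \<Rightarrow> complex) \<Rightarrow> complex \<Rightarrow> bool" where
  "indexed_eigenvalue V A \<mu> \<longleftrightarrow>
     (\<exists>x. (\<exists>i\<in>V. x i \<noteq> 0) \<and> (\<forall>i\<in>V. (\<Sum>j\<in>V. A i j * x j) = \<mu> * x i))"

definition weighted_graph_eigenvalue ::
    "'v set \<Rightarrow> 'v set set \<Rightarrow> ('v \<Rightarrow> complex) \<Rightarrow> complex \<Rightarrow> bool" where
  "weighted_graph_eigenvalue V E \<pi> \<mu> \<longleftrightarrow> indexed_eigenvalue V (weighted_adjacency E \<pi>) \<mu>"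

text \<open>Under any enumeration of the index set, \<^const>\<open>indexed_eigenvalue\<close> is the usual
  \<^const>\<open>eigenvalue\<close> of a square matrix.\<close>

lemma indexed_eigenvalue_iff_eigenvalue:
  assumes f: "bij_betw f {0..<n} V"
  shows "indexed_eigenvalue V A \<mu> \<longleftrightarrow> eigenvalue (mat n n (\<lambda>(i, j). A (f i) (f j))) \<mu>"
proof -
  let ?M = "mat n n (\<lambda>(i, j). A (f i) (f j))"
  let ?g = "inv_into {0..<n} f"
  have V: "V = f ` {0..<n}" and inj: "inj_on f {0..<n}"
    using f by (auto simp: bij_betw_def)
  have sum_f: "(\<Sum>j\<in>V. h j) = (\<Sum>j = 0..<n. h (f j))" for h :: "_ \<Rightarrow> complex"
    using sum.reindex_bij_betw[OF f, of h] by simp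
  have ev: "eigenvector ?M v \<mu> \<longleftrightarrow> dim_vec v = n \<and> (\<exists>i<n. v $ i \<noteq> 0) \<and>
      (\<forall>i<n. (\<Sum>j = 0..<n. A (f i) (f j) * v $ j) = \<mu> * v $ i)" for v
  proof -
    have "?M *\<^sub>v v = \<mu> \<cdot>\<^sub>v v \<longleftrightarrow>
        (\<forall>i<n. (\<Sum>j = 0..<n. A (f i) (f j) * v $ j) = \<mu> * v $ i)" if "dim_vec v = n"
      unfolding vec_eq_iff using that by (simp add: scalar_prod_def)
    moreover have "v \<noteq> 0\<^sub>v n \<longleftrightarrow> (\<exists>i<n. v $ i \<noteq> 0)" if "dim_vec v = n"
      unfolding vec_eq_iff using that by simp
    ultimately show ?thesis
      unfolding eigenvector_def carrier_vec_def by auto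
  qed
  show ?thesis
  proof
    assume "indexed_eigenvalue V A \<mu>"
    then obtain x where "\<exists>i\<in>V. x i \<noteq> 0" "\<forall>i\<in>V. (\<Sum>j\<in>V. A i j * x j) = \<mu> * x i"
      unfolding indexed_eigenvalue_def by blast
    then have "eigenvector ?M (vec n (\<lambda>i. x (f i))) \<mu>"
      unfolding ev sum_f by (auto simp: V)
    then show "eigenvalue ?M \<mu>"
      unfolding eigenvalue_def by blast
  next
    assume "eigenvalue ?M \<mu>"
    then obtain v where v: "eigenvector ?M v \<mu>"
      unfolding eigenvalue_def by blast
    have g: "?g (f i) = i" if "i < n" for i
      using inj that by simp
    have "(\<exists>i\<in>V. v $ ?g i \<noteq> 0) \<and> (\<forall>i\<in>V. (\<Sum>j\<in>V. A i j * v $ ?g j) = \<mu> * v $ ?g i)"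
      using v unfolding ev sum_f by (auto simp: V g)
    then show "indexed_eigenvalue V A \<mu>"
      unfolding indexed_eigenvalue_def by (intro exI[of _ "\<lambda>i. v $ ?g i"])
  qed
qed

lemma hypergraph_eigenvalue_iff:
  assumes H: "uniform_hypergraph k V E" and k: "k > 0"
  shows "hypergraph_eigenvalue k V E \<mu> \<longleftrightarrow>
     (\<exists>x. (\<exists>v\<in>V. x v \<noteq> 0) \<and>
       (\<forall>v\<in>V. \<mu> * x v ^ (k - 1) = (\<Sum>e | e \<in> E \<and> v \<in> e. \<Prod>u\<in>e - {v}. x u)))"
proof -
  have finV: "finite V" and E: "\<And>e. e \<in> E \<Longrightarrow> e \<subseteq> V \<and> card e = k"
    using H by (auto simp: uniform_hypergraph_def)
  have finE: "finite E"
    by (rule finite_subset[of _ "Pow V"]) (use E finV in auto)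
  have finVe: "finite e" if "e \<in> E" for e
    using E[OF that] finV finite_subset by blast
  have "(\<Sum>vs | set vs \<subseteq> V \<and> length vs = k - 1. adjacency_tensor k E (v # vs) * (\<Prod>u\<leftarrow>vs. x u))
      = (\<Sum>e | e \<in> E \<and> v \<in> e. \<Prod>u\<in>e - {v}. x u)" (is "?L = ?R")
    if v: "v \<in> V" for v and x :: "'a \<Rightarrow> complex"
  proof -
    let ?S = "{e. e \<in> E \<and> v \<in> e}"
    let ?P = "\<lambda>e. permutations_of_set (e - {v})"
    have U: "{vs. set vs \<subseteq> V \<and> length vs = k - 1 \<and> insert v (set vs) \<in> E} = (\<Union>e\<in>?S. ?P e)"
    proof (intro equalityI subsetI)
      fix vs assume "vs \<in> {vs. set vs \<subseteq> V \<and> length vs = k - 1 \<and> insert v (set vs) \<in> E}"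
      then have len: "length vs = k - 1" and e: "insert v (set vs) \<in> E" by auto
      have "card (set (v # vs)) = length (v # vs)"
        using E[OF e] len k by simp
      then have "distinct (v # vs)"
        by (rule card_distinct)
      then have "vs \<in> ?P (insert v (set vs))"
        by (auto simp: permutations_of_set_def)
      with e show "vs \<in> (\<Union>e\<in>?S. ?P e)" by blast
    next
      fix vs assume "vs \<in> (\<Union>e\<in>?S. ?P e)"
      then obtain e where e: "e \<in> E" "v \<in> e" and vs: "set vs = e - {v}" "distinct vs"
        by (auto simp: permutations_of_set_def)
      have "length vs = k - 1"
        using distinct_card[OF vs(2)] vs(1) e E[OF e(1)] finVe[OF e(1)] by simp
      moreover have "insert v (set vs) = e" using vs e by auto
      moreover have "set vs \<subseteq> V" using vs E[OF e(1)] by auto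
      ultimately show "vs \<in> {vs. set vs \<subseteq> V \<and> length vs = k - 1 \<and> insert v (set vs) \<in> E}"
        using e by simp
    qed
    have "?L = (\<Sum>vs | set vs \<subseteq> V \<and> length vs = k - 1 \<and> insert v (set vs) \<in> E.
        1 / fact (k - 1) * (\<Prod>u\<leftarrow>vs. x u))"
      by (rule sum.mono_neutral_cong_right)
        (use k in \<open>auto simp: adjacency_tensor_def finite_lists_length_eq[OF finV]\<close>)
    also have "\<dots> = (\<Sum>e\<in>?S. \<Sum>vs\<in>?P e. 1 / fact (k - 1) * (\<Prod>u\<leftarrow>vs. x u))"
      unfolding U
      by (rule sum.UNION_disjoint) (use finE finVe in \<open>auto dest!: permutations_of_setD(1)\<close>)
    also have "\<dots> = ?R"
    proof (rule sum.cong)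
      fix e assume "e \<in> ?S"
      then have e: "e \<in> E" "v \<in> e" by auto
      have "(\<Sum>vs\<in>?P e. 1 / fact (k - 1) * (\<Prod>u\<leftarrow>vs. x u))
          = (\<Sum>vs\<in>?P e. 1 / fact (k - 1) * (\<Prod>u\<in>e - {v}. x u))"
      proof (rule sum.cong)
        fix vs assume "vs \<in> ?P e"
        then have "set vs = e - {v}" "distinct vs"
          by (rule permutations_of_setD)+
        then have "(\<Prod>u\<leftarrow>vs. x u) = (\<Prod>u\<in>e - {v}. x u)"
          using prod.distinct_set_conv_list[of vs x] by simp
        then show "1 / fact (k - 1) * (\<Prod>u\<leftarrow>vs. x u) = 1 / fact (k - 1) * (\<Prod>u\<in>e - {v}. x u)"
          by simp
      qed simp
      also have "\<dots> = (\<Prod>u\<in>e - {v}. x u)"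
      proof -
        have "card (?P e) = fact (k - 1)"
          using finVe[OF e(1)] E[OF e(1)] e(2) by simp
        then show ?thesis by simp
      qed
      finally show "(\<Sum>vs\<in>?P e. 1 / fact (k - 1) * (\<Prod>u\<leftarrow>vs. x u)) = (\<Prod>u\<in>e - {v}. x u)" .
    qed simp
    finally show ?thesis .
  qed
  then show ?thesis
    unfolding hypergraph_eigenvalue_def tensor_eigenvalue_def by simp
qed

lemma uniform_hypergraph_blowup:
  assumes G: "finite_simple_graph V E" and B: "blowup_classes s V B"
  shows "uniform_hypergraph (2 * s) (blowup_verts B V) (blowup_edges B E)"
  unfolding uniform_hypergraph_def
proof (intro conjI ballI)
  show "finite (blowup_verts B V)"
    using assms by (auto simp: uniform_hypergraph_def blowup_classes_def blowup_verts_def)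
next
  fix e assume "e \<in> blowup_edges B E"
  then obtain i j where e: "e = B i \<union> B j" and ij: "{i, j} \<in> E"
    by (auto simp: blowup_edges_def)
  have "{i, j} \<subseteq> V" and card: "card {i, j} = 2"
    using G ij unfolding uniform_hypergraph_def by blast+
  then have V: "i \<in> V" "j \<in> V" by blast+
  have "i \<noteq> j" using card by (cases "i = j") simp_all
  then have disj: "B i \<inter> B j = {}"
    using V B unfolding blowup_classes_def disjoint_family_on_def by blast
  have fin: "finite (B i)" "finite (B j)" and "card (B i) = s" "card (B j) = s"
    using V B unfolding blowup_classes_def by blast+
  then show "card e = 2 * s"
    unfolding e card_Un_disjoint[OF fin disj] by simp
  show "e \<subseteq> blowup_verts B V"
    using V by (auto simp: e blowup_verts_def)
qed

lemma blowup_classes_canonical: "blowup_classes s V (\<lambda>i. {i} \<times> {..<s})"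
  by (auto simp: blowup_classes_def disjoint_family_on_def)

end

theory Submission
  imports Defs
begin

text \<open>
  For a vector \<open>y\<close> on the blowup put \<open>p i = (\<Prod>w\<in>B i. y w)\<close>. Multiplied by \<open>y u\<close>, the eigenvalue
  equation at a vertex \<open>u\<close> of the class \<open>B i\<close> reads \<open>\<mu> * y u ^ (2 * s) = p i * (\<Sum>j. p j)\<close>, the sum
  being over the neighbours \<open>j\<close> of \<open>i\<close>. If \<open>\<mu> \<noteq> 0\<close>, then within a class the entries of \<open>y\<close> differ
  only by \<open>2 * s\<close>-th roots of unity, so that \<open>p i = \<pi> i * z i\<close> where \<open>z i\<close> is the \<open>s\<close>-th power of
  one entry and \<open>\<pi> i\<close> is such a root; cancelling \<open>z i\<close> on the classes where \<open>y\<close> does not vanish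
  gives \<open>\<mu> * z i = \<pi> i * (\<Sum>j. \<pi> j * z j)\<close>. Conversely, \<open>s\<close>-th roots of \<open>z i\<close> on \<open>B i\<close>, one of them
  multiplied by \<open>\<pi> i\<close>, form an eigenvector of the blowup. The value \<open>\<mu> = 0\<close> belongs to every
  single vertex.
\<close>

lemma simple_graph_edgeD:
  assumes "finite_simple_graph V E" and "{i, j} \<in> E"
  shows "i \<in> V" and "j \<in> V" and "i \<noteq> j"
proof -
  have "{i, j} \<subseteq> V" "card {i, j} = 2"
    using assms unfolding uniform_hypergraph_def by blast+
  then show "i \<in> V" "j \<in> V" "i \<noteq> j"
    by (auto simp: card_insert_if)
qed

lemma complex_nth_root_exists:
  assumes "n > 0"
  shows "\<exists>w::complex. w ^ n = z"
proof -
  have "rcis (root n (cmod z)) (Arg z / n) ^ n = rcis (cmod z) (Arg z)"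
    using assms by (simp add: DeMoivre2)
  then show ?thesis
    by (metis rcis_cmod_Arg)
qed

text \<open>As the classes are disjoint, an edge through \<open>u\<close> must be
  \<open>B i \<union> B j\<close> with \<open>j\<close> a neighbour of \<open>i\<close>; deleting
  \<open>u\<close> then affects only the factor coming from \<open>B i\<close>.\<close>

lemma blowup_sum_edges:
  fixes y :: "'w \<Rightarrow> complex"
  assumes G: "finite_simple_graph V E" and s: "s > 0" and B: "blowup_classes s V B"
    and i: "i \<in> V" and u: "u \<in> B i"
  shows "(\<Sum>e | e \<in> blowup_edges B E \<and> u \<in> e. \<Prod>w\<in>e - {u}. y w) =
    (\<Prod>w\<in>B i - {u}. y w) * (\<Sum>j | {i, j} \<in> E. \<Prod>w\<in>B j. y w)"
proof -
  have disj: "B k \<inter> B l = {}" if "k \<in> V" "l \<in> V" "k \<noteq> l" for k l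
    using B that unfolding blowup_classes_def disjoint_family_on_def by blast
  have fin: "finite (B k)" and ne: "B k \<noteq> {}" if "k \<in> V" for k
    using B s that unfolding blowup_classes_def by auto
  have nbr: "B j \<inter> B i = {}" "j \<in> V" if "{i, j} \<in> E" for j
    using simple_graph_edgeD[OF G that] disj by auto
  have edges: "{e. e \<in> blowup_edges B E \<and> u \<in> e} = (\<lambda>j. B i \<union> B j) ` {j. {i, j} \<in> E}"
  proof (intro equalityI subsetI)
    fix e assume "e \<in> {e. e \<in> blowup_edges B E \<and> u \<in> e}"
    then obtain k l where e: "e = B k \<union> B l" and kl: "{k, l} \<in> E" and "u \<in> B k \<or> u \<in> B l"
      by (auto simp: blowup_edges_def)
    then have "k = i \<or> l = i"
      using simple_graph_edgeD[OF G kl] disj i u by blast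
    then show "e \<in> (\<lambda>j. B i \<union> B j) ` {j. {i, j} \<in> E}"
      using e kl by (auto simp: insert_commute Un_commute)
  qed (use u in \<open>auto simp: blowup_edges_def\<close>)
  \<comment> \<open>The left-hand sum runs over sets, so distinct neighbours must yield distinct
    unions. They do, because disjoint nonempty classes differ; nonemptiness is where
    \<open>s > 0\<close> enters.\<close>
  have inj: "inj_on (\<lambda>j. B i \<union> B j) {j. {i, j} \<in> E}"
  proof (rule inj_onI)
    fix j k assume jk: "j \<in> {j. {i, j} \<in> E}" "k \<in> {j. {i, j} \<in> E}" and eq: "B i \<union> B j = B i \<union> B k"
    then have "B j = B k" using nbr(1)[of j] nbr(1)[of k] by blast
    then show "j = k"
      using disj[of j k] ne[of j] nbr(2) jk by auto
  qed
  have "(\<Prod>w\<in>(B i \<union> B j) - {u}. y w) = (\<Prod>w\<in>B i - {u}. y w) * (\<Prod>w\<in>B j. y w)"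
    if "{i, j} \<in> E" for j
  proof -
    have "(B i \<union> B j) - {u} = (B i - {u}) \<union> B j"
      using nbr[OF that] u by blast
    moreover have "(B i - {u}) \<inter> B j = {}"
      using nbr[OF that] by blast
    ultimately show ?thesis
      using fin[OF i] fin[OF nbr(2)[OF that]] by (simp add: prod.union_disjoint)
  qed
  then show ?thesis
    unfolding edges by (simp add: sum.reindex[OF inj] sum_distrib_left)
qed

lemma blowup_eigenvalue_iff:
  assumes G: "finite_simple_graph V E" and s: "s > 0" and B: "blowup_classes s V B"
  shows "hypergraph_eigenvalue (2 * s) (blowup_verts B V) (blowup_edges B E) \<mu> \<longleftrightarrow>
    (\<exists>y. (\<exists>i\<in>V. \<exists>u\<in>B i. y u \<noteq> 0) \<and>
      (\<forall>i\<in>V. \<forall>u\<in>B i. \<mu> * y u ^ (2 * s - 1) =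
        (\<Prod>w\<in>B i - {u}. y w) * (\<Sum>j | {i, j} \<in> E. \<Prod>w\<in>B j. y w)))"
proof -
  have "2 * s > 0" using s by simp
  note iff = hypergraph_eigenvalue_iff[OF uniform_hypergraph_blowup[OF G B] this]
  show ?thesis
    unfolding iff using blowup_sum_edges[OF G s B]
    by (simp add: blowup_verts_def)
qed

lemma weighted_induced_eigenvalue_iff:
  assumes "finite W"
  shows "weighted_graph_eigenvalue W (induced_edges E W) \<pi> \<mu> \<longleftrightarrow>
    (\<exists>z. (\<exists>i\<in>W. z i \<noteq> 0) \<and>
      (\<forall>i\<in>W. \<pi> i * (\<Sum>j | j \<in> W \<and> {i, j} \<in> E. \<pi> j * z j) = \<mu> * z i))"
proof -
  have "(\<Sum>j\<in>W. weighted_adjacency (induced_edges E W) \<pi> i j * z j) =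
      \<pi> i * (\<Sum>j | j \<in> W \<and> {i, j} \<in> E. \<pi> j * z j)" if "i \<in> W" for i and z
    unfolding sum_distrib_left
    by (rule sum.mono_neutral_cong_right)
      (use assms that in \<open>auto simp: weighted_adjacency_def induced_edges_def\<close>)
  then show ?thesis
    unfolding weighted_graph_eigenvalue_def indexed_eigenvalue_def by simp
qed

lemma weighted_eigenvalue_of_blowup_eigenvalue:
  assumes G: "finite_simple_graph V E" and s: "s > 0" and B: "blowup_classes s V B"
    and ev: "hypergraph_eigenvalue (2 * s) (blowup_verts B V) (blowup_edges B E) \<mu>"
  shows "\<exists>W \<pi>. W \<subseteq> V \<and> W \<noteq> {} \<and> root_weighting (2 * s) W \<pi> \<and>
    weighted_graph_eigenvalue W (induced_edges E W) \<pi> \<mu>"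
proof -
  obtain y i0 u0 where i0: "i0 \<in> V" and u0: "u0 \<in> B i0" "y u0 \<noteq> 0"
    and y: "\<And>i u. i \<in> V \<Longrightarrow> u \<in> B i \<Longrightarrow> \<mu> * y u ^ (2 * s - 1) =
        (\<Prod>w\<in>B i - {u}. y w) * (\<Sum>j | {i, j} \<in> E. \<Prod>w\<in>B j. y w)"
    using ev unfolding blowup_eigenvalue_iff[OF G s B] by blast
  have finV: "finite V"
    using G unfolding uniform_hypergraph_def by blast
  have fin: "finite (B i)" and card: "card (B i) = s" if "i \<in> V" for i
    using B that unfolding blowup_classes_def by auto
  define p where "p i = (\<Prod>w\<in>B i. y w)" for i
  define S where "S i = (\<Sum>j | {i, j} \<in> E. p j)" for i
  show ?thesis
  proof (cases "\<mu> = 0")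
    case True
    have noloop: "{i0} \<notin> E"
      using simple_graph_edgeD(3)[OF G, of i0 i0] by auto
    have "weighted_graph_eigenvalue {i0} (induced_edges E {i0}) (\<lambda>_. 1) \<mu>"
      unfolding weighted_induced_eigenvalue_iff[OF finite.insertI[OF finite.emptyI]]
      by (intro exI[of _ "\<lambda>_. 1"]) (auto simp: True noloop)
    then show ?thesis
      using i0 by (intro exI[of _ "{i0}"] exI[of _ "\<lambda>_. 1"]) (simp add: root_weighting_def)
  next
    case False
    have eq: "\<mu> * y u ^ (2 * s) = p i * S i" if "i \<in> V" "u \<in> B i" for i u
    proof -
      have "\<mu> * y u ^ (2 * s) = y u * (\<mu> * y u ^ (2 * s - 1))"
        using s power_minus_mult[of "2 * s" "y u"] by (simp add: mult_ac)
      also have "\<dots> = p i * S i"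
        unfolding y[OF that] p_def S_def
        using prod.remove[OF fin[OF that(1)] that(2), of y] by simp
      finally show ?thesis .
    qed
    define c where "c i = (SOME u. u \<in> B i)" for i
    have c: "c i \<in> B i" if "i \<in> V" for i
      unfolding c_def some_in_eq using card[OF that] s by auto
    \<comment> \<open>The right side of \<open>eq\<close> depends only on the class, and \<mu>
      \<noteq> 0 cancels.\<close>
    have same: "y u ^ (2 * s) = y (c i) ^ (2 * s)" if "i \<in> V" "u \<in> B i" for i u
      using eq[OF that] eq[OF that(1) c[OF that(1)]] False by (metis mult_left_cancel)
    \<comment> \<open>By \<open>same\<close>, \<open>y\<close> vanishes either everywhere or nowhere
      on a class, so testing the representative \<open>c i\<close> is enough.\<close>
    define W where "W = {i \<in> V. y (c i) \<noteq> 0}"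
    define z where "z i = y (c i) ^ s" for i
    define \<pi> where "\<pi> i = (\<Prod>w\<in>B i. y w / y (c i))" for i
    have WV: "W \<subseteq> V" unfolding W_def by blast
    have i0W: "i0 \<in> W"
      using same[OF i0 u0(1)] u0(2) i0 s unfolding W_def by (auto simp: power_0_left)
    have root: "\<pi> i ^ (2 * s) = 1" if "i \<in> W" for i
      using that same[of i] unfolding \<pi>_def W_def
      by (simp add: prod_power_distrib power_divide)
    have p_W: "p i = \<pi> i * z i" if "i \<in> W" for i
      using that card[of i] unfolding p_def \<pi>_def z_def W_def by (simp add: prod_dividef)
    have p_0: "p i = 0" if "i \<in> V" "i \<notin> W" for i
      using that fin[of i] c[of i] unfolding p_def W_def by (auto intro!: prod_zero)
    \<comment> \<open>Neighbours outside \<open>W\<close> have \<open>p j = 0\<close>; this is how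
      the induced subgraph on \<open>W\<close> arises.\<close>
    have S_W: "S i = (\<Sum>j | j \<in> W \<and> {i, j} \<in> E. \<pi> j * z j)" for i
      unfolding S_def
    proof (rule sum.mono_neutral_cong_right)
      show "finite {j. {i, j} \<in> E}"
        by (rule finite_subset[OF _ finV]) (use simple_graph_edgeD(2)[OF G] in blast)
    qed (use p_W p_0 simple_graph_edgeD(2)[OF G] in auto)
    have "\<pi> i * S i = \<mu> * z i" if "i \<in> W" for i
    proof -
      have "z i \<noteq> 0" using that unfolding W_def z_def by simp
      \<comment> \<open>This is \<open>eq\<close> at \<open>u = c i\<close>, where
        \<open>y u ^ (2 * s)\<close> is the square of \<open>z i\<close>.\<close>
      moreover have "z i * (\<mu> * z i) = z i * (\<pi> i * S i)"
        using eq[of i "c i"] c[of i] that WV p_W[OF that]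
        by (auto simp: z_def power_mult power2_eq_square power_mult_distrib mult_ac power_even_eq)
      ultimately show ?thesis by (metis mult_left_cancel)
    qed
    then have "weighted_graph_eigenvalue W (induced_edges E W) \<pi> \<mu>"
      unfolding weighted_induced_eigenvalue_iff[OF finite_subset[OF WV finV]] S_W
      using i0W by (intro exI[of _ z]) (auto simp: z_def W_def)
    then show ?thesis
      using WV i0W root unfolding root_weighting_def by blast
  qed
qed

text \<open>The blowup equations are also required on classes outside \<open>W\<close>, about which
  the subgraph says nothing. There the vector is zero, and s \<ge> 2 leaves a zero factor on the
  right-hand side.\<close>

lemma blowup_eigenvalue_of_weighted_eigenvalue:
  assumes G: "finite_simple_graph V E" and s: "s \<ge> 2" and B: "blowup_classes s V B"
    and WV: "W \<subseteq> V" and root: "root_weighting (2 * s) W \<pi>"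
    and ev: "weighted_graph_eigenvalue W (induced_edges E W) \<pi> \<mu>"
  shows "hypergraph_eigenvalue (2 * s) (blowup_verts B V) (blowup_edges B E) \<mu>"
proof -
  have s0: "s > 0" using s by simp
  have finV: "finite V"
    using G unfolding uniform_hypergraph_def by blast
  have fin: "finite (B i)" and card: "card (B i) = s" if "i \<in> V" for i
    using B that unfolding blowup_classes_def by auto
  obtain z i0 where i0: "i0 \<in> W" "z i0 \<noteq> 0"
    and z: "\<And>i. i \<in> W \<Longrightarrow> \<pi> i * (\<Sum>j | j \<in> W \<and> {i, j} \<in> E. \<pi> j * z j) = \<mu> * z i"
    using ev unfolding weighted_induced_eigenvalue_iff[OF finite_subset[OF WV finV]] by blast
  \<comment> \<open>Extending \<open>z\<close> by zero makes the roots \<open>x i\<close> vanish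
    outside \<open>W\<close>.\<close>
  have "\<forall>i. \<exists>w. w ^ s = (if i \<in> W then z i else 0)"
    using complex_nth_root_exists[OF s0] by blast
  then obtain x where x: "\<And>i. x i ^ s = (if i \<in> W then z i else 0)"
    by metis
  define c where "c i = (SOME u. u \<in> B i)" for i
  have c: "c i \<in> B i" if "i \<in> V" for i
    unfolding c_def some_in_eq using card[OF that] s by auto
  define cls where "cls u = (THE i. i \<in> V \<and> u \<in> B i)" for u
  have cls: "cls u = i" if "i \<in> V" "u \<in> B i" for i u
    unfolding cls_def using that B
    by (intro the_equality) (auto simp: blowup_classes_def disjoint_family_on_def)
  \<comment> \<open>Twisting a single vertex puts exactly one factor \<open>\<pi> i\<close> into the
    class product, while \<open>y u ^ (2 * s)\<close> does not see it, since \<open>\<pi> i\<close>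
    is a root of unity on \<open>W\<close>.\<close>
  define y where "y u = x (cls u) * (if u = c (cls u) then \<pi> (cls u) else 1)" for u
  have y: "y u = x i * (if u = c i then \<pi> i else 1)" if "i \<in> V" "u \<in> B i" for i u
    unfolding y_def cls[OF that] ..
  have p: "(\<Prod>w\<in>B i. y w) = (if i \<in> W then \<pi> i * z i else 0)" if "i \<in> V" for i
  proof -
    have "(\<Prod>w\<in>B i. y w) = (\<Prod>w\<in>B i. x i * (if w = c i then \<pi> i else 1))"
      by (rule prod.cong) (use y[OF that] in auto)
    also have "\<dots> = x i ^ s * \<pi> i"
      using c[OF that] fin[OF that] card[OF that] by (simp add: prod.distrib)
    finally show ?thesis using x[of i] by simp
  qed
  have S: "(\<Sum>j | {i, j} \<in> E. \<Prod>w\<in>B j. y w) = (\<Sum>j | j \<in> W \<and> {i, j} \<in> E. \<pi> j * z j)" for i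
  proof (rule sum.mono_neutral_cong_right)
    show "finite {j. {i, j} \<in> E}"
      by (rule finite_subset[OF _ finV]) (use simple_graph_edgeD(2)[OF G] in blast)
  qed (use p simple_graph_edgeD(2)[OF G] in \<open>auto split: if_splits\<close>)
  have "\<mu> * y u ^ (2 * s - 1) =
      (\<Prod>w\<in>B i - {u}. y w) * (\<Sum>j | {i, j} \<in> E. \<Prod>w\<in>B j. y w)" (is "?l = ?r")
    if i: "i \<in> V" and u: "u \<in> B i" for i u
  proof (cases "x i = 0")
    case True
    \<comment> \<open>As \<open>s \<ge> 2\<close>, the class has a second vertex, where \<open>y\<close> vanishes too.\<close>
    have "card (B i - {u}) > 0" using card[OF i] fin[OF i] u s by simp
    then obtain w where "w \<in> B i - {u}" by (auto simp: card_gt_0_iff)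
    then have "(\<Prod>w\<in>B i - {u}. y w) = 0"
      using fin[OF i] y[OF i] True by (intro prod_zero) auto
    then show ?thesis
      using y[OF i u] True s by simp
  next
    case False
    then have iW: "i \<in> W" using x[of i] s by (metis power_eq_0_iff)
    have \<pi>: "\<pi> i ^ (2 * s) = 1" using root iW unfolding root_weighting_def by blast
    then have "\<pi> i \<noteq> 0" using s by (auto simp: power_0_left)
    then have yu: "y u \<noteq> 0" using y[OF i u] False by simp
    have "y u ^ (2 * s) = z i ^ 2"
      using y[OF i u] \<pi> x[of i] iW by (simp add: power_mult_distrib power_even_eq)
    \<comment> \<open>Both sides are compared after multiplication by \<open>y u \<noteq> 0\<close>,
      which completes the product over \<open>B i - {u}\<close> to the class product given by
      \<open>p\<close>.\<close>
    then have "y u * ?l = \<mu> * z i ^ 2"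
      using s power_minus_mult[of "2 * s" "y u"] by (simp add: mult_ac)
    also have "\<dots> = z i * (\<pi> i * (\<Sum>j | j \<in> W \<and> {i, j} \<in> E. \<pi> j * z j))"
      unfolding z[OF iW] by (simp add: power2_eq_square)
    also have "\<dots> = y u * ?r"
      using prod.remove[OF fin[OF i] u, of y] p[OF i] iW unfolding S by (simp add: mult_ac)
    finally show ?thesis using yu by simp
  qed
  moreover have "\<exists>i\<in>V. \<exists>u\<in>B i. y u \<noteq> 0"
  proof -
    have i0V: "i0 \<in> V" using i0 WV by blast
    have "(\<Prod>w\<in>B i0. y w) \<noteq> 0"
    proof -
      have "\<pi> i0 ^ (2 * s) = 1" using root i0 unfolding root_weighting_def by blast
      then have "\<pi> i0 \<noteq> 0" using s by (auto simp: power_0_left)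
      then show ?thesis using p[OF i0V] i0 by simp
    qed
    then have "y (c i0) \<noteq> 0"
      using c[OF i0V] fin[OF i0V] by auto
    then show ?thesis using c[OF i0V] i0V by blast
  qed
  ultimately show ?thesis
    unfolding blowup_eigenvalue_iff[OF G s0 B] by blast
qed

theorem theorem1:
  fixes V :: "'v set" and E :: "'v set set" and s :: nat
    and B :: "'v \<Rightarrow> 'w set" and \<mu> :: complex
  assumes "finite_simple_graph V E"
    and "s \<ge> 2"
    and "blowup_classes s V B"
  shows "hypergraph_eigenvalue (2 * s) (blowup_verts B V) (blowup_edges B E) \<mu> \<longleftrightarrow>
    (\<exists>W \<pi>. W \<subseteq> V \<and> W \<noteq> {} \<and> root_weighting (2 * s) W \<pi> \<and>
      weighted_graph_eigenvalue W (induced_edges E W) \<pi> \<mu>)"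
proof -
  have "s > 0" using assms(2) by simp
  then show ?thesis
    using weighted_eigenvalue_of_blowup_eigenvalue[OF assms(1) _ assms(3)]
      blowup_eigenvalue_of_weighted_eigenvalue[OF assms] by blast
qed

end
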